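(* Let $f,k,\Phi,[a,b],c$ satisfy the standing assumptions in the context, and let $K$, $m$, $M$ be as defined there. Assume that one of the following conditions holds: (1) $f(u)<m\,u$ for all $u>0$; (2) $f(u)>M\,u$ for all $u>0$. Then the integral equation $$u(t)=\int_0^1k(t,s)f(u(s))\,ds,\qquad t\in[0,1],$$ has no non-trivial solution in $K$ (i.e. no solution $u\in K$ with $u\not\equiv0$).
   Context: Standing assumptions: $f:[0,+\infty)\to[0,+\infty)$ and $k:[0,1]\times[0,1]\to[0,+\infty)$ are continuous; there exist a continuous function $\Phi:[0,1]\to[0,+\infty)$, an interval $[a,b]\subset[0,1]$ and a constant $c\in(0,1]$ such that $k(t,s)\le\Phi(s)$ for $t,s\in[0,1]$ and $c\,\Phi(s)\le k(t,s)$ for $t\in[a,b]$, $s\in[0,1]$; and $\int_a^b\Phi(s)\,ds>0$. $C[0,1]$ carries the norm $\|u\|=\max_{t\in[0,1]}|u(t)|$, and $$K=\{u\in C[0,1]: u\ge0,\ \min_{t\in[a,b]}u(t)\ge c\|u\|\}.$$ The constants are $\frac1m=\sup_{t\in[0,1]}\int_0^1k(t,s)\,ds$ and $\frac1M=\inf_{t\in[a,b]}\int_a^bk(t,s)\,ds$. *)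

theory Defs
  imports "HOL-Analysis.Analysis"
begin

text \<open>
  Elements of \<open>C[0,1]\<close> are represented by functions on all of \<open>\<real>\<close> that are continuous on
  \<open>{0..1}\<close>; their values outside \<open>{0..1}\<close> are irrelevant throughout, so equality of such
  functions always means equality on \<open>{0..1}\<close>.
\<close>
definition C01 :: "(real \<Rightarrow> real) set" where
  "C01 = {u. continuous_on {0..1} u}"

text \<open>
  For continuous functions on nonempty compact intervals, \<open>SUP\<close> and \<open>INF\<close> are the maximum and
  the minimum (\<open>Max\<close> and \<open>Min\<close> of the library are for finite sets only).
\<close>
definition norm01 :: "(real \<Rightarrow> real) \<Rightarrow> real" where
  "norm01 u = (SUP t\<in>{0..1}. \<bar>u t\<bar>)"

definition cone_K :: "real \<Rightarrow> real \<Rightarrow> real \<Rightarrow> (real \<Rightarrow> real) set" where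
  "cone_K a b c =
     {u \<in> C01. (\<forall>t\<in>{0..1}. 0 \<le> u t) \<and> (INF t\<in>{a..b}. u t) \<ge> c * norm01 u}"

text \<open>
  The constants are specified through their reciprocals. Under the standing assumptions
  (in particular \<open>0 < integral {a..b} \<Phi>\<close>) both reciprocals are positive reals, so the
  divisions below are genuine.
\<close>
definition m_const :: "(real \<Rightarrow> real \<Rightarrow> real) \<Rightarrow> real" where
  "m_const k = 1 / (SUP t\<in>{0..1}. integral {0..1} (\<lambda>s. k t s))"

definition M_const :: "(real \<Rightarrow> real \<Rightarrow> real) \<Rightarrow> real \<Rightarrow> real \<Rightarrow> real" where
  "M_const k a b = 1 / (INF t\<in>{a..b}. integral {a..b} (\<lambda>s. k t s))"

definition hammerstein_solution ::
    "(real \<Rightarrow> real \<Rightarrow> real) \<Rightarrow> (real \<Rightarrow> real) \<Rightarrow> (real \<Rightarrow> real) \<Rightarrow> bool" where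
  "hammerstein_solution k f u \<longleftrightarrow>
     (\<forall>t\<in>{0..1}. u t = integral {0..1} (\<lambda>s. k t s * f (u s)))"

end

theory Submission
  imports Defs
begin

text \<open>
  In case (1), evaluate the equation at a maximum point of \<open>u\<close>; in case (2), at a minimum point
  of \<open>u\<close> on \<open>{a..b}\<close>, where the cone condition makes \<open>u\<close> strictly positive. To keep the
  inequalities strict under the integral, \<open>f \<circ> u\<close> is replaced by its extreme value
  on the compact interval.
\<close>

text \<open>The strict bound is available only for positive arguments; letting \<open>x\<close> tend
  to 0 from the right carries it over to 0 in weak form. This covers points where \<open>u\<close>
  vanishes in the first case.\<close>

lemma continuous_less_linear_at_zero:
  fixes f :: "real \<Rightarrow> real"
  assumes "continuous_on {0..} f" and "\<forall>x>0. f x < m * x"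
  shows "f 0 \<le> 0"
proof (rule tendsto_le[OF trivial_limit_at_right_real])
  have "(f \<longlongrightarrow> f 0) (at 0 within {0..})"
    using assms(1) by (auto simp: continuous_on)
  then show "(f \<longlongrightarrow> f 0) (at_right 0)"
    by (rule tendsto_within_subset) auto
  show "((\<lambda>x. m * x) \<longlongrightarrow> 0) (at_right 0)"
    by (auto intro!: tendsto_eq_intros)
  show "\<forall>\<^sub>F x in at_right 0. f x \<le> m * x"
    using assms(2) by (auto simp: eventually_at_filter intro!: always_eventually less_imp_le)
qed

lemma abs_le_norm01:
  assumes "u \<in> C01" "t \<in> {0..1}"
  shows "\<bar>u t\<bar> \<le> norm01 u"
  unfolding norm01_def
proof (rule cSUP_upper[OF assms(2)])
  have "compact ((\<lambda>t. \<bar>u t\<bar>) ` {0..1})"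
    using assms(1) by (intro compact_continuous_image continuous_intros) (auto simp: C01_def)
  then show "bdd_above ((\<lambda>t. \<bar>u t\<bar>) ` {0..1})"
    by (intro bounded_imp_bdd_above compact_imp_bounded)
qed

text \<open>A nonzero value at \<open>t0\<close> makes \<open>norm01 u\<close> positive, and the
  cone condition passes this on to the infimum over \<open>{a..b}\<close>, which is a true lower
  bound because \<open>u\<close> is bounded below by 0.\<close>

lemma cone_K_pos:
  assumes "u \<in> cone_K a b c" "0 < c" "0 \<le> a" "b \<le> 1" "t0 \<in> {0..1}" "u t0 \<noteq> 0" "t \<in> {a..b}"
  shows "0 < u t"
proof -
  have u: "u \<in> C01" and lower: "c * norm01 u \<le> (INF t\<in>{a..b}. u t)"
    and nonneg: "\<forall>t\<in>{0..1}. 0 \<le> u t"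
    using assms(1) by (auto simp: cone_K_def)
  have "0 < norm01 u"
    using abs_le_norm01[OF u assms(5)] assms(6) by linarith
  then have "0 < c * norm01 u"
    using assms(2) by simp
  also have "\<dots> \<le> u t"
    using lower assms
    by (rule_tac order_trans[OF lower], intro cINF_lower)
       (auto intro!: bdd_belowI2[where m = 0] nonneg[rule_format])
  finally show ?thesis .
qed

theorem theorem2p1p1:
  fixes f \<Phi> :: "real \<Rightarrow> real" and k :: "real \<Rightarrow> real \<Rightarrow> real" and a b c :: real
  assumes f_cont: "continuous_on {0..} f"
    and f_nonneg: "\<forall>x\<ge>0. 0 \<le> f x"
    and k_cont: "continuous_on ({0..1} \<times> {0..1}) (\<lambda>(t, s). k t s)"
    and k_nonneg: "\<forall>t\<in>{0..1}. \<forall>s\<in>{0..1}. 0 \<le> k t s"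
    and Phi_cont: "continuous_on {0..1} \<Phi>"
    and Phi_nonneg: "\<forall>s\<in>{0..1}. 0 \<le> \<Phi> s"
    and ab: "0 \<le> a" "a \<le> b" "b \<le> 1"
    and c: "0 < c" "c \<le> 1"
    and k_upper: "\<forall>t\<in>{0..1}. \<forall>s\<in>{0..1}. k t s \<le> \<Phi> s"
    and k_lower: "\<forall>t\<in>{a..b}. \<forall>s\<in>{0..1}. c * \<Phi> s \<le> k t s"
    and Phi_pos: "0 < integral {a..b} \<Phi>"
    and cond: "(\<forall>x>0. f x < m_const k * x) \<or> (\<forall>x>0. f x > M_const k a b * x)"
  shows "\<not> (\<exists>u \<in> cone_K a b c. hammerstein_solution k f u \<and> (\<exists>t\<in>{0..1}. u t \<noteq> 0))"
proof
  assume "\<exists>u \<in> cone_K a b c. hammerstein_solution k f u \<and> (\<exists>t\<in>{0..1}. u t \<noteq> 0)"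
  then obtain u t0 where uK: "u \<in> cone_K a b c"
    and sol: "\<And>t. t \<in> {0..1} \<Longrightarrow> u t = integral {0..1} (\<lambda>s. k t s * f (u s))"
    and t0: "t0 \<in> {0..1}" "u t0 \<noteq> 0"
    by (auto simp: hammerstein_solution_def)
  have u_cont: "continuous_on {0..1} u" and u_nonneg: "\<And>t. t \<in> {0..1} \<Longrightarrow> 0 \<le> u t"
    using uK by (auto simp: cone_K_def C01_def)
  have sub: "{a..b} \<subseteq> {0..1}"
    using ab by auto
  have fu_cont: "continuous_on {0..1} (\<lambda>s. f (u s))"
    by (rule continuous_on_compose2[OF f_cont u_cont]) (auto intro: u_nonneg)
  have kt_cont: "continuous_on {0..1} (k t)" if "t \<in> {0..1}" for t
    using continuous_on_compose2[OF k_cont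
        continuous_on_Pair[OF continuous_on_const continuous_on_id], of t "{0..1}"] that
    by force
  have kf_int: "(\<lambda>s. k t s * f (u s)) integrable_on {0..1}" if "t \<in> {0..1}" for t
    by (intro integrable_continuous_real continuous_intros kt_cont fu_cont that)
  have k_int: "k t integrable_on {0..1}" if "t \<in> {0..1}" for t
    by (intro integrable_continuous_real kt_cont that)
  have k_int_ab: "k t integrable_on {a..b}" if "t \<in> {0..1}" for t
    using integrable_on_subinterval[OF k_int[OF that] sub] .
  have Phi_int: "\<Phi> integrable_on {0..1}"
    by (rule integrable_continuous_real[OF Phi_cont])
  have Phi_int_ab: "\<Phi> integrable_on {a..b}"
    using integrable_on_subinterval[OF Phi_int sub] .
  \<comment> \<open>This bound is uniform in \<open>t\<close>: it gives positivity of both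
    reciprocals \<open>S\<close> and \<open>I\<close> below, and boundedness from below for the
    infimum \<open>I\<close>.\<close>
  have k_ab_lower: "c * integral {a..b} \<Phi> \<le> integral {a..b} (k t)" if "t \<in> {a..b}" for t
  proof -
    have "integral {a..b} (\<lambda>s. c * \<Phi> s) \<le> integral {a..b} (k t)"
      using that sub k_lower
      by (intro integral_le k_int_ab integrable_on_mult_right Phi_int_ab) auto
    then show ?thesis
      by simp
  qed
  have cPhi_pos: "0 < c * integral {a..b} \<Phi>"
    using c Phi_pos by simp
  from cond show False
  proof
    assume less: "\<forall>x>0. f x < m_const k * x"
    define S where "S = (SUP t\<in>{0..1}. integral {0..1} (k t))"
    have m: "m_const k = 1 / S"
      by (simp add: m_const_def S_def)
    \<comment> \<open>The majorant \<Phi> bounds all these integrals at once, so the supremum is a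
      genuine upper bound.\<close>
    have S_upper: "integral {0..1} (k t) \<le> S" if "t \<in> {0..1}" for t
      unfolding S_def
      by (intro cSUP_upper that bdd_aboveI2[where M = "integral {0..1} \<Phi>"])
         (use k_upper in \<open>auto intro!: integral_le k_int Phi_int\<close>)
    have "c * integral {a..b} \<Phi> \<le> integral {a..b} (k a)"
      using ab by (intro k_ab_lower) auto
    also have "\<dots> \<le> integral {0..1} (k a)"
      using ab sub k_nonneg by (intro integral_subset_le k_int k_int_ab) auto
    also have "\<dots> \<le> S"
      using ab by (intro S_upper) auto
    finally have S_pos: "0 < S"
      using cPhi_pos by simp
    obtain t1 where t1: "t1 \<in> {0..1}" "\<And>t. t \<in> {0..1} \<Longrightarrow> u t \<le> u t1"
      using continuous_attains_sup[OF compact_Icc _ u_cont] by auto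
    \<comment> \<open>As \<open>f\<close> need not be monotone, the maximum of
      \<open>f (u s)\<close> may lie at a point other than \<open>t1\<close>.\<close>
    obtain s1 where s1: "s1 \<in> {0..1}" "\<And>s. s \<in> {0..1} \<Longrightarrow> f (u s) \<le> f (u s1)"
      using continuous_attains_sup[OF compact_Icc _ fu_cont] by auto
    have ut1: "0 < u t1"
      using t1(2)[OF t0(1)] u_nonneg[OF t0(1)] t0(2) by linarith
    \<comment> \<open>All the strictness of the case sits in this pointwise inequality, so weak
      monotonicity of the integral suffices afterwards. If \<open>u s1 = 0\<close>, it comes from
      \<open>u t1\<close> being positive.\<close>
    have fs1: "f (u s1) < u t1 / S"
    proof (cases "u s1 = 0")
      case True
      then have "f (u s1) \<le> 0"
        using continuous_less_linear_at_zero[OF f_cont less] by simp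
      also have "0 < u t1 / S"
        using ut1 S_pos by simp
      finally show ?thesis .
    next
      case False
      then have "f (u s1) < u s1 / S"
        using less u_nonneg[OF s1(1)] m by simp
      also have "\<dots> \<le> u t1 / S"
        using t1(2)[OF s1(1)] S_pos by (simp add: divide_right_mono)
      finally show ?thesis .
    qed
    have "u t1 = integral {0..1} (\<lambda>s. k t1 s * f (u s))"
      by (rule sol[OF t1(1)])
    also have "\<dots> \<le> integral {0..1} (\<lambda>s. k t1 s * f (u s1))"
      using k_nonneg t1(1) s1(2)
      by (intro integral_le kf_int integrable_on_mult_left k_int mult_left_mono) auto
    also have "\<dots> = integral {0..1} (k t1) * f (u s1)"
      by simp
    also have "\<dots> \<le> S * f (u s1)"
      using f_nonneg u_nonneg[OF s1(1)] by (intro mult_right_mono S_upper t1) auto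
    also have "\<dots> < u t1"
      using fs1 S_pos by (simp add: field_simps)
    finally show False
      by simp
  next
    assume greater: "\<forall>x>0. f x > M_const k a b * x"
    define I where "I = (INF t\<in>{a..b}. integral {a..b} (k t))"
    have M: "M_const k a b = 1 / I"
      by (simp add: M_const_def I_def)
    have I_lower: "I \<le> integral {a..b} (k t)" if "t \<in> {a..b}" for t
      unfolding I_def
      by (intro cINF_lower that bdd_belowI2[where m = "c * integral {a..b} \<Phi>"] k_ab_lower)
    \<comment> \<open>Positivity of each single integral would not by itself exclude the infimum 0;
      the uniform bound does.\<close>
    have "c * integral {a..b} \<Phi> \<le> I"
      unfolding I_def using ab by (intro cINF_greatest k_ab_lower) auto
    then have I_pos: "0 < I"
      using cPhi_pos by simp
    have ne: "{a..b} \<noteq> {}"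
      using ab by simp
    obtain t1 where t1: "t1 \<in> {a..b}" "\<And>t. t \<in> {a..b} \<Longrightarrow> u t1 \<le> u t"
      using continuous_attains_inf[OF compact_Icc ne continuous_on_subset[OF u_cont sub]] by auto
    obtain s1 where s1: "s1 \<in> {a..b}" "\<And>s. s \<in> {a..b} \<Longrightarrow> f (u s1) \<le> f (u s)"
      using continuous_attains_inf[OF compact_Icc ne continuous_on_subset[OF fu_cont sub]] by auto
    \<comment> \<open>Positivity at \<open>s1\<close> is what allows the strict hypothesis on
      \<open>f\<close> to be applied there.\<close>
    have us1: "0 < u s1"
      using cone_K_pos[OF uK c(1) ab(1,3) t0 s1(1)] .
    have t1': "t1 \<in> {0..1}"
      using t1(1) sub by auto
    have "u t1 / I \<le> u s1 / I"
      using t1(2)[OF s1(1)] I_pos by (simp add: divide_right_mono)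
    also have "\<dots> < f (u s1)"
      using greater us1 M by simp
    finally have "u t1 < I * f (u s1)"
      using I_pos by (simp add: field_simps)
    also have "\<dots> \<le> integral {a..b} (k t1) * f (u s1)"
      using f_nonneg us1 by (intro mult_right_mono I_lower t1) auto
    also have "\<dots> = integral {a..b} (\<lambda>s. k t1 s * f (u s1))"
      by simp
    also have "\<dots> \<le> integral {a..b} (\<lambda>s. k t1 s * f (u s))"
      using k_nonneg t1' s1(2) sub
      by (intro integral_le integrable_on_subinterval[OF kf_int sub] integrable_on_mult_left
          k_int_ab mult_left_mono) auto
    \<comment> \<open>The integrand is nonnegative, so enlarging the domain from
      \<open>{a..b}\<close> can only increase the integral.\<close>
    also have "\<dots> \<le> integral {0..1} (\<lambda>s. k t1 s * f (u s))"
      using k_nonneg t1' f_nonneg u_nonneg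
      by (intro integral_subset_le sub integrable_on_subinterval[OF kf_int sub] kf_int) auto
    also have "\<dots> = u t1"
      using sol[OF t1'] by simp
    finally show False
      by simp
  qed
qed

end
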